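(* The smallest order $n$ of a graph having $n-2$ very typical vertices is $10$, and the smallest order $n$ of a graph having $n-2$ typical vertices is $9$.
   Context: All graphs are finite and simple. The order of a graph is its number of vertices. For a vertex $v$, $d(v)$ denotes its degree and $N(v)$ its (open) neighborhood. A vertex $u$ is very typical if $d(u)\ge 2$, every $v\in N(u)$ satisfies $d(v)\ne d(u)$, at least one $x\in N(u)$ has $d(x)>d(u)$, and at least one $y\in N(u)$ has $d(y)<d(u)$. A vertex $u$ is typical if $d(u)\ge 3$ and there are three distinct vertices $x,y,z\in N(u)$ satisfying $d(x)<d(u)=d(y)<d(z)$.
   Formalization: The smallest order is taken among graphs of order n at least 3, since every graph of order 2 trivially has n-2 = 0 very typical and 0 typical vertices, so that without this restriction the smallest order would be 2. *)

theory Defs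
  imports "Graph_Theory.Pair_Digraph"
begin

text \<open>
  A finite simple graph is a pair digraph satisfying \<^locale>\<open>pair_graph\<close>: the vertex set is finite
  and the arc relation is symmetric and irreflexive on it. Each edge is represented by
  its two opposite arcs, so the number of edges at a vertex is its out-degree.
\<close>

definition nbhd :: "'a pair_pre_digraph \<Rightarrow> 'a \<Rightarrow> 'a set" where
  "nbhd G u = {v. (u, v) \<in> parcs G}"

definition deg :: "'a pair_pre_digraph \<Rightarrow> 'a \<Rightarrow> nat" where
  "deg G u = out_degree (with_proj G) u"

definition very_typical :: "'a pair_pre_digraph \<Rightarrow> 'a \<Rightarrow> bool" where
  "very_typical G u \<longleftrightarrow>
     deg G u \<ge> 2 \<and>
     (\<forall>v\<in>nbhd G u. deg G v \<noteq> deg G u) \<and>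
     (\<exists>x\<in>nbhd G u. deg G x > deg G u) \<and>
     (\<exists>y\<in>nbhd G u. deg G y < deg G u)"

definition typical :: "'a pair_pre_digraph \<Rightarrow> 'a \<Rightarrow> bool" where
  "typical G u \<longleftrightarrow>
     deg G u \<ge> 3 \<and>
     (\<exists>x\<in>nbhd G u. \<exists>y\<in>nbhd G u. \<exists>z\<in>nbhd G u.
        x \<noteq> y \<and> y \<noteq> z \<and> x \<noteq> z \<and>
        deg G x < deg G u \<and> deg G u = deg G y \<and> deg G y < deg G z)"

text \<open>
  Every graph of order 2 has no vertex of either kind, hence trivially has \<open>n - 2\<close>
  of them; this degenerate case is excluded by \<open>n \<ge> 3\<close>, which also makes
  the subtraction on \<^typ>\<open>nat\<close> exact.
\<close>

definition all_but_two ::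
  "('a pair_pre_digraph \<Rightarrow> 'a \<Rightarrow> bool) \<Rightarrow> nat \<Rightarrow> 'a pair_pre_digraph \<Rightarrow> bool" where
  "all_but_two P n G \<longleftrightarrow>
     pair_graph G \<and> card (pverts G) = n \<and> n \<ge> 3 \<and>
     card {u \<in> pverts G. P G u} = n - 2"

end

theory Submission
  imports Defs
begin

text \<open>
  The two exceptional vertices are the unique vertices of maximum and minimum degree. Sort the
  vertices into classes of equal degree, let \<open>L\<close> be the union of the lowest classes and \<open>H\<close> a union
  of higher ones. The edges between \<open>H\<close> and \<open>L\<close> are at least as many as the degrees in \<open>H\<close> force,
  and at most as many as the degrees in \<open>L\<close> leave room for, since every vertex of \<open>L\<close> except the
  minimum already uses up an edge inside \<open>L\<close>. Together with the strict increase of the degrees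
  from class to class, this inequality excludes every sequence of class sizes of too small total.
\<close>

section \<open>A cut inequality\<close>

lemma sum_card_swap:
  assumes "finite A" "finite B"
  shows "(\<Sum>x\<in>A. card {y \<in> B. R x y}) = (\<Sum>y\<in>B. card {x \<in> A. R x y})"
  using sum.swap_restrict[OF assms, of "\<lambda>_ _. 1::nat" R] by simp

context pair_graph
begin

lemma nbhd_subset: "nbhd G u \<subseteq> pverts G"
  by (auto simp: nbhd_def dest: in_arcsD2)

lemma finite_nbhd: "finite (nbhd G u)"
  using nbhd_subset pair_finite_verts by (rule finite_subset)

lemma nbhd_sym: "v \<in> nbhd G u \<longleftrightarrow> u \<in> nbhd G v"
  using pair_sym_arcs by (auto simp: nbhd_def symmetric_def sym_def)

lemma nbhd_irrefl: "u \<notin> nbhd G u"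
  using pair_no_loops by (fastforce simp: nbhd_def)

lemma deg_eq_card_nbhd: "deg G u = card (nbhd G u)"
proof -
  have "out_arcs (with_proj G) u = Pair u ` nbhd G u"
    by (auto simp: out_arcs_def nbhd_def)
  then show ?thesis
    by (simp add: deg_def out_degree_def card_image inj_on_def)
qed

text \<open>Every vertex of \<open>L\<close> other than \<open>b\<close> sends an edge downwards inside \<open>L\<close>; this edge is
  counted twice in the degree sum of \<open>L\<close>, once at each end.\<close>

lemma cut_inequality:
  assumes sub: "L \<subseteq> pverts G" "H \<subseteq> pverts G" "M \<subseteq> pverts G"
    and disj: "L \<inter> H = {}" "L \<inter> M = {}" "H \<inter> M = {}"
    and b: "b \<in> L"
    and low: "\<And>u. u \<in> L - {b} \<Longrightarrow> \<exists>v\<in>L \<inter> nbhd G u. deg G v < deg G u"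
    and eq: "\<And>u. u \<in> L - {b} \<Longrightarrow> \<epsilon> \<le> card {v \<in> L \<inter> nbhd G u. deg G v = deg G u}"
    and M: "\<And>v. v \<in> M \<Longrightarrow> nbhd G v \<inter> L \<noteq> {}"
  shows "(\<Sum>v\<in>H. card (nbhd G v \<inter> L)) + (2 + \<epsilon>) * (card L - 1) + card M \<le> (\<Sum>u\<in>L. deg G u)"
proof -
  let ?N = "nbhd G" and ?d = "deg G"
  have fin: "finite L" "finite H" "finite M"
    using sub pair_finite_verts finite_subset by blast+
  \<comment> \<open>The neighbours of \<open>u\<close> in \<open>L\<close> of smaller, larger and
    equal degree, then those in \<open>H\<close> and in \<open>M\<close>: disjoint parts of its
    neighbourhood, so their sizes add up to at most its degree.\<close>
  let ?A = "\<lambda>u. {v \<in> L. v \<in> ?N u \<and> ?d v < ?d u}" and ?B = "\<lambda>u. {v \<in> L. v \<in> ?N u \<and> ?d u < ?d v}"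
    and ?C = "\<lambda>u. {v \<in> L \<inter> ?N u. ?d v = ?d u}"
    and ?H = "\<lambda>u. {v \<in> H. v \<in> ?N u}" and ?M = "\<lambda>u. {v \<in> M. v \<in> ?N u}"
  have split: "card (?A u) + card (?B u) + card (?C u) + card (?H u) + card (?M u) \<le> ?d u" for u
  proof -
    have fins: "finite (?A u)" "finite (?B u)" "finite (?C u)" "finite (?H u)" "finite (?M u)"
      using fin by auto
    have disjs: "?A u \<inter> ?B u = {}" "(?A u \<union> ?B u) \<inter> ?C u = {}"
      "(?A u \<union> ?B u \<union> ?C u) \<inter> ?H u = {}" "(?A u \<union> ?B u \<union> ?C u \<union> ?H u) \<inter> ?M u = {}"
      using disj by auto
    have "card (?A u) + card (?B u) + card (?C u) + card (?H u) + card (?M u)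
        = card (?A u \<union> ?B u \<union> ?C u \<union> ?H u \<union> ?M u)"
      by (simp only: card_Un_disjoint[OF _ _ disjs(1)] card_Un_disjoint[OF _ _ disjs(2)]
          card_Un_disjoint[OF _ _ disjs(3)] card_Un_disjoint[OF _ _ disjs(4)] finite_UnI fins)
    also have "\<dots> \<le> ?d u"
      unfolding deg_eq_card_nbhd by (intro card_mono finite_nbhd) auto
    finally show ?thesis .
  qed
  have flip: "(\<Sum>u\<in>L. card (?B u)) = (\<Sum>u\<in>L. card (?A u))"
    unfolding sum_card_swap[OF fin(1) fin(1), of "\<lambda>u v. v \<in> ?N u \<and> ?d u < ?d v"]
    by (intro sum.cong refl arg_cong[where f = card]) (auto simp: nbhd_sym)
  have bound: "k * (card L - 1) \<le> (\<Sum>u\<in>L. f u)" if "\<And>u. u \<in> L - {b} \<Longrightarrow> k \<le> f u"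
    for k :: nat and f
  proof -
    have "k * (card L - 1) = (\<Sum>u\<in>L - {b}. k)" using b fin by simp
    also have "\<dots> \<le> (\<Sum>u\<in>L - {b}. f u)" using that by (intro sum_mono) auto
    also have "\<dots> \<le> (\<Sum>u\<in>L. f u)" using fin by (intro sum_mono2) auto
    finally show ?thesis .
  qed
  have A: "1 * (card L - 1) \<le> (\<Sum>u\<in>L. card (?A u))"
  proof (rule bound)
    fix u assume "u \<in> L - {b}"
    then have "?A u \<noteq> {}" using low[of u] by auto
    then show "1 \<le> card (?A u)" using fin by (simp add: Suc_le_eq card_gt_0_iff)
  qed
  \<comment> \<open>No doubling here: the bound on equal-degree neighbours is assumed at both ends
    of such an edge.\<close>
  have C: "\<epsilon> * (card L - 1) \<le> (\<Sum>u\<in>L. card (?C u))"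
    using eq by (rule bound)
  have H: "(\<Sum>u\<in>L. card (?H u)) = (\<Sum>v\<in>H. card (?N v \<inter> L))"
    unfolding sum_card_swap[OF fin(1,2)]
    by (intro sum.cong refl arg_cong[where f = card]) (auto simp: nbhd_sym)
  have "card M = (\<Sum>v\<in>M. 1)" by simp
  also have "\<dots> \<le> (\<Sum>v\<in>M. card {u \<in> L. v \<in> ?N u})"
  proof (rule sum_mono)
    fix v assume "v \<in> M"
    then have "{u \<in> L. v \<in> ?N u} \<noteq> {}" using M[of v] nbhd_sym by auto
    then show "1 \<le> card {u \<in> L. v \<in> ?N u}" using fin by (simp add: Suc_le_eq card_gt_0_iff)
  qed
  also have "\<dots> = (\<Sum>u\<in>L. card (?M u))" using sum_card_swap[OF fin(1,3)] by simp
  finally have M': "card M \<le> (\<Sum>u\<in>L. card (?M u))" .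
  have "(\<Sum>v\<in>H. card (?N v \<inter> L)) + (2 + \<epsilon>) * (card L - 1) + card M
     \<le> (\<Sum>u\<in>L. card (?A u) + card (?B u) + card (?C u) + card (?H u) + card (?M u))"
    using A C H M' flip by (simp add: sum.distrib algebra_simps)
  also have "\<dots> \<le> (\<Sum>u\<in>L. ?d u)" using split by (rule sum_mono)
  finally show ?thesis .
qed

end

section \<open>Graphs with two exceptional vertices\<close>

text \<open>Shared setting for both kinds of vertices. Larger neighbours survive only as the strict
  bound by the degree of \<open>a\<close>; what tells the two kinds apart enters
  \<open>class_cut\<close> through \<epsilon> and \<sigma>.\<close>

locale two_extremes = pair_graph G for G :: "'a pair_pre_digraph" +
  fixes a b :: 'a
  assumes a: "a \<in> pverts G" and b: "b \<in> pverts G"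
    and extremal: "\<And>v. v \<in> pverts G - {a, b} \<Longrightarrow> deg G b < deg G v \<and> deg G v < deg G a"
    and lower: "\<And>v. v \<in> pverts G - {a, b} \<Longrightarrow> \<exists>y\<in>nbhd G v. deg G y < deg G v"
    and ba: "deg G b < deg G a"
    and order: "3 \<le> card (pverts G)"
begin

section \<open>Degree classes, numbered by increasing degree\<close>

definition num_degrees :: nat where
  "num_degrees = card (deg G ` pverts G)"

definition D :: "nat \<Rightarrow> nat" where
  "D j = sorted_list_of_set (deg G ` pverts G) ! j"

definition C :: "nat \<Rightarrow> 'a set" where
  "C j = {v \<in> pverts G. deg G v = D j}"

text \<open>Integers, because the summands of the cut inequality may be negative.\<close>

definition c :: "nat \<Rightarrow> int" where
  "c j = int (card (C j))"

lemma finite_C: "finite (C j)"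
  by (simp add: C_def pair_finite_verts)

lemma D_strict: "i < j \<Longrightarrow> j < num_degrees \<Longrightarrow> D i < D j"
  unfolding D_def num_degrees_def
  by (intro sorted_wrt_nth_less[OF strict_sorted_list_of_set]) simp_all

lemma D_image: "D ` {..<num_degrees} = deg G ` pverts G"
proof -
  let ?S = "deg G ` pverts G"
  have "D ` {..<num_degrees} = set (sorted_list_of_set ?S)"
    unfolding D_def num_degrees_def by (auto simp: set_conv_nth)
  then show ?thesis by (simp add: pair_finite_verts)
qed

lemma D_less_iff: "i < num_degrees \<Longrightarrow> j < num_degrees \<Longrightarrow> D i < D j \<longleftrightarrow> i < j"
  by (metis D_strict less_asym linorder_neqE_nat)

lemma D_inj: "i < num_degrees \<Longrightarrow> j < num_degrees \<Longrightarrow> D i = D j \<Longrightarrow> i = j"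
  by (metis D_strict less_irrefl linorder_neqE_nat)

lemma C_cases:
  assumes "v \<in> pverts G" obtains j where "j < num_degrees" "v \<in> C j"
proof -
  have "deg G v \<in> D ` {..<num_degrees}" using assms D_image by blast
  then show ?thesis using assms that by (auto simp: C_def)
qed

lemma C_disjoint: "i < num_degrees \<Longrightarrow> j < num_degrees \<Longrightarrow> i \<noteq> j \<Longrightarrow> C i \<inter> C j = {}"
  using D_inj by (auto simp: C_def)

lemma c_pos:
  assumes "j < num_degrees" shows "1 \<le> c j"
proof -
  have "D j \<in> deg G ` pverts G" using assms D_image by blast
  then have "C j \<noteq> {}" by (auto simp: C_def)
  then show ?thesis using finite_C[of j] card_gt_0_iff[of "C j"] by (simp add: c_def)
qed

lemma sum_classes:
  assumes "S \<subseteq> {..<num_degrees}"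
  shows "(\<Sum>v\<in>(\<Union>j\<in>S. C j). f v) = (\<Sum>j\<in>S. \<Sum>v\<in>C j. f v)"
proof (rule sum.UNION_disjoint)
  show "finite S" using assms finite_lessThan by (rule finite_subset)
  show "\<forall>j\<in>S. finite (C j)" by (simp add: finite_C)
  show "\<forall>i\<in>S. \<forall>j\<in>S. i \<noteq> j \<longrightarrow> C i \<inter> C j = {}" using assms C_disjoint by blast
qed

lemma card_classes:
  assumes "S \<subseteq> {..<num_degrees}"
  shows "int (card (\<Union>j\<in>S. C j)) = (\<Sum>j\<in>S. c j)"
  using sum_classes[OF assms, of "\<lambda>_. 1::int"] by (simp add: c_def)

lemma order_eq: "int (card (pverts G)) = (\<Sum>j<num_degrees. c j)"
proof -
  have "pverts G = (\<Union>j\<in>{..<num_degrees}. C j)"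
    using C_cases by (auto simp: C_def)
  then show ?thesis using card_classes[of "{..<num_degrees}"] by simp
qed

lemma deg_bounds: "v \<in> pverts G \<Longrightarrow> deg G b \<le> deg G v \<and> deg G v \<le> deg G a"
  using extremal[of v] ba by (cases "v = a \<or> v = b") auto

text \<open>Some vertex lies outside \<open>{a, b}\<close>, and its degree is strictly between the
  extreme ones.\<close>

lemma num_degrees_ge: "3 \<le> num_degrees"
proof -
  have "\<not> pverts G \<subseteq> {a, b}"
    using order card_mono[of "{a, b}" "pverts G"] card_insert_le_m1[of 2 "{b}" a] by auto
  then obtain v where v: "v \<in> pverts G" "v \<notin> {a, b}" by blast
  have "card {deg G a, deg G b, deg G v} = 3" using extremal[of v] v by auto
  moreover have "card {deg G a, deg G b, deg G v} \<le> num_degrees"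
    unfolding num_degrees_def using a b v pair_finite_verts by (intro card_mono) auto
  ultimately show ?thesis by simp
qed

lemma D_first: "D 0 = deg G b" and D_last: "D (num_degrees - 1) = deg G a"
proof -
  have K: "0 < num_degrees" "num_degrees - 1 < num_degrees" using num_degrees_ge by auto
  obtain i where i: "i < num_degrees" "b \<in> C i" using C_cases[OF b] .
  obtain j where j: "j < num_degrees" "a \<in> C j" using C_cases[OF a] .
  have "D 0 \<in> deg G ` pverts G" "D (num_degrees - 1) \<in> deg G ` pverts G"
    using K D_image by blast+
  then have "deg G b \<le> D 0" "D (num_degrees - 1) \<le> deg G a"
    using deg_bounds by auto
  moreover have "D 0 \<le> D i" "D j \<le> D (num_degrees - 1)"
    using D_strict[of 0 i] D_strict[of j "num_degrees - 1"] i j K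
    by (metis le_less not_gr_zero, metis One_nat_def Suc_pred le_less less_Suc_eq)
  ultimately show "D 0 = deg G b" "D (num_degrees - 1) = deg G a"
    using i j by (auto simp: C_def)
qed

lemma C_first: "C 0 = {b}" and C_last: "C (num_degrees - 1) = {a}"
  using extremal a b ba unfolding C_def D_first D_last by force+

text \<open>The number \<open>\<sigma> j\<close> bounds from below the non-neighbours, including itself, of a vertex in its
  own class: it is the class size for very typical vertices, and 1 for typical ones.\<close>

lemma class_cut:
  assumes t: "Suc t < num_degrees - 1" and s: "t < s" and e: "e \<le> num_degrees"
    and eq: "\<And>v. v \<in> pverts G - {a, b} \<Longrightarrow> \<epsilon> \<le> card {u \<in> nbhd G v. deg G u = deg G v}"
    and \<sigma>: "\<And>j v. j < num_degrees \<Longrightarrow> v \<in> C j \<Longrightarrow> \<sigma> j \<le> int (card (C j - nbhd G v))"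
    and l: "l = (\<Sum>j\<le>t. c j)"
  shows "(\<Sum>j=s..<e. c j * (int (D j) + \<sigma> j + l - int (card (pverts G))))
      + (2 + int \<epsilon>) * (l - 1) + (if Suc t < s then c (Suc t) else 0) \<le> (\<Sum>j\<le>t. c j * int (D j))"
proof -
  let ?n = "card (pverts G)"
  define L where "L = (\<Union>j\<in>{..t}. C j)"
  define H where "H = (\<Union>j\<in>{s..<e}. C j)"
  \<comment> \<open>The class just above \<open>L\<close> is added only when \<open>H\<close> starts
    later, so that no edge is counted twice. All smaller degrees belong to \<open>L\<close>, hence
    each of its vertices has its lower neighbour there.\<close>
  define M where "M = (if Suc t < s then C (Suc t) else {})"
  have idx: "{..t} \<subseteq> {..<num_degrees}" "{s..<e} \<subseteq> {..<num_degrees}" using t e by auto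
  have L_iff: "v \<in> L \<longleftrightarrow> deg G v \<le> D t" if v: "v \<in> pverts G" for v
  proof -
    obtain j where j: "j < num_degrees" "v \<in> C j" using C_cases[OF v] .
    have "i = j" if "i \<le> t" "v \<in> C i" for i
      by (rule D_inj) (use that j t in \<open>auto simp: C_def\<close>)
    then have "v \<in> L \<longleftrightarrow> j \<le> t" using j unfolding L_def by blast
    also have "\<dots> \<longleftrightarrow> D j \<le> D t" using D_less_iff[of t j] j t by linarith
    finally show ?thesis using j by (simp add: C_def)
  qed
  have C_sub: "C j \<subseteq> pverts G" for j by (auto simp: C_def)
  have sub: "L \<subseteq> pverts G" "H \<subseteq> pverts G" "M \<subseteq> pverts G"
    using C_sub unfolding L_def H_def M_def by (auto split: if_splits)
  have finL: "finite L" using sub pair_finite_verts finite_subset by blast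
  have above: "v \<notin> L" if "v \<in> C j" "t < j" "j < num_degrees" for v j
    using that D_strict[of t j] L_iff[of v] by (auto simp: C_def)
  have disj: "L \<inter> H = {}" "L \<inter> M = {}" "H \<inter> M = {}"
  proof -
    have "v \<notin> L" if v: "v \<in> H" for v
    proof -
      obtain j where "v \<in> C j" "j \<in> {s..<e}" using v unfolding H_def by blast
      then show ?thesis using above[of v j] s e by simp
    qed
    then show "L \<inter> H = {}" by blast
    show "L \<inter> M = {}" using above[of _ "Suc t"] t unfolding M_def by auto
    show "H \<inter> M = {}"
    proof (cases "Suc t < s")
      case True
      have "C j \<inter> C (Suc t) = {}" if "j \<in> {s..<e}" for j
        using C_disjoint[of j "Suc t"] that True t e by simp
      moreover have "M = C (Suc t)" using True by (simp add: M_def)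
      ultimately show ?thesis unfolding H_def by blast
    qed (simp add: M_def)
  qed
  have notL: "a \<notin> L" using L_iff[OF a] D_strict[of t "num_degrees - 1"] D_last t by auto
  have bL: "b \<in> L" using C_first unfolding L_def by auto
  have inner: "u \<in> pverts G - {a, b}" if "u \<in> L - {b}" for u
    using that sub notL by auto
  have cut_nat: "(\<Sum>v\<in>H. card (nbhd G v \<inter> L)) + (2 + \<epsilon>) * (card L - 1) + card M \<le> (\<Sum>u\<in>L. deg G u)"
  proof (rule cut_inequality[OF sub disj bL])
    fix u assume u: "u \<in> L - {b}"
    have du: "deg G u \<le> D t" using u L_iff sub by blast
    \<comment> \<open>\<open>L\<close> is closed downwards in degree, so the smaller and
      equal-degree neighbours of its vertices stay inside.\<close>
    have down: "v \<in> L" if "v \<in> nbhd G u" "deg G v \<le> deg G u" for v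
      using that du L_iff nbhd_subset by (meson order.trans subsetD)
    show "\<exists>v\<in>L \<inter> nbhd G u. deg G v < deg G u"
      using lower[OF inner[OF u]] down by (meson IntI order.strict_implies_order)
    have "{v \<in> nbhd G u. deg G v = deg G u} \<subseteq> {v \<in> L \<inter> nbhd G u. deg G v = deg G u}"
      using down by auto
    then have "card {v \<in> nbhd G u. deg G v = deg G u} \<le> card {v \<in> L \<inter> nbhd G u. deg G v = deg G u}"
      using finL by (intro card_mono) simp_all
    then show "\<epsilon> \<le> card {v \<in> L \<inter> nbhd G u. deg G v = deg G u}"
      using eq[OF inner[OF u]] by linarith
  next
    fix v assume "v \<in> M"
    then have v: "v \<in> C (Suc t)" unfolding M_def by (auto split: if_splits)
    have "Suc t < num_degrees" "num_degrees - 1 < num_degrees" "0 < num_degrees"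
      "Suc t \<noteq> num_degrees - 1" "Suc t \<noteq> 0" using t by auto
    then have "C (Suc t) \<inter> {a} = {}" "C (Suc t) \<inter> {b} = {}"
      using C_disjoint unfolding C_last[symmetric] C_first[symmetric] by blast+
    then have "v \<in> pverts G" "v \<noteq> a" "v \<noteq> b" using v by (auto simp: C_def)
    then obtain y where y: "y \<in> nbhd G v" "deg G y < deg G v" using lower[of v] by auto
    have "y \<in> pverts G" using y nbhd_subset by blast
    then obtain j where j: "j < num_degrees" "y \<in> C j" by (rule C_cases)
    have "D j < D (Suc t)" using y j v by (simp add: C_def)
    then have "j \<le> t" using D_less_iff[of j "Suc t"] j t by simp
    then have "y \<in> L" using j unfolding L_def by auto
    then show "nbhd G v \<inter> L \<noteq> {}" using y by auto
  qed
  have L1: "1 \<le> card L" using bL finL by (auto simp: Suc_le_eq card_gt_0_iff)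
  have "int ((\<Sum>v\<in>H. card (nbhd G v \<inter> L)) + (2 + \<epsilon>) * (card L - 1) + card M) \<le> int (\<Sum>u\<in>L. deg G u)"
    using cut_nat by (simp only: of_nat_le_iff)
  then have cut: "(\<Sum>v\<in>H. int (card (nbhd G v \<inter> L))) + (2 + int \<epsilon>) * (int (card L) - 1)
      + int (card M) \<le> (\<Sum>u\<in>L. int (deg G u))"
    using L1 by (simp only: of_nat_add of_nat_mult of_nat_sum of_nat_diff of_nat_numeral of_nat_1)
  have cardL: "int (card L) = l" using card_classes[OF idx(1)] unfolding L_def l by simp
  have degL: "(\<Sum>u\<in>L. int (deg G u)) = (\<Sum>j\<le>t. c j * int (D j))"
    unfolding L_def sum_classes[OF idx(1)] c_def by (intro sum.cong) (auto simp: C_def)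
  have cardM: "int (card M) = (if Suc t < s then c (Suc t) else 0)"
    by (simp add: M_def c_def)
  \<comment> \<open>Of the \<open>n - l\<close> vertices outside \<open>L\<close>, at least
    \<open>\<sigma> j\<close> lie in the class of \<open>v\<close> without being neighbours of
    \<open>v\<close>. The other neighbours of \<open>v\<close> must be in \<open>L\<close>, which
    makes at least \<open>D j - (n - l - \<sigma> j)\<close> of them.\<close>
  have "(\<Sum>j=s..<e. c j * (int (D j) + \<sigma> j + l - int ?n))
      = (\<Sum>j=s..<e. \<Sum>v\<in>C j. int (D j) + \<sigma> j + l - int ?n)"
    by (simp add: c_def)
  also have "\<dots> \<le> (\<Sum>j=s..<e. \<Sum>v\<in>C j. int (card (nbhd G v \<inter> L)))"
  proof (intro sum_mono)
    fix j v assume j: "j \<in> {s..<e}" and v: "v \<in> C j"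
    have jK: "j < num_degrees" "t < j" using j s e by auto
    have CL: "C j \<inter> L = {}"
      using above[OF _ jK(2,1)] by blast
    have "card (nbhd G v - L) + card (C j - nbhd G v) = card ((nbhd G v - L) \<union> (C j - nbhd G v))"
      using finite_nbhd finite_C by (intro card_Un_disjoint[symmetric]) auto
    also have "\<dots> \<le> card (pverts G - L)"
      using nbhd_subset C_sub CL pair_finite_verts by (intro card_mono) auto
    also have "\<dots> = ?n - card L" using sub finL by (intro card_Diff_subset) auto
    finally have 1: "card (nbhd G v - L) + card (C j - nbhd G v) \<le> ?n - card L" .
    have "D j = card (nbhd G v)" using v by (simp add: C_def deg_eq_card_nbhd)
    also have "\<dots> = card (nbhd G v \<inter> L) + card (nbhd G v - L)"
      by (metis card_Int_Diff finite_nbhd)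
    finally have 2: "D j = card (nbhd G v \<inter> L) + card (nbhd G v - L)" .
    have "card L \<le> ?n" using sub pair_finite_verts by (intro card_mono)
    with 1 2 \<sigma>[OF jK(1) v] cardL
    show "int (D j) + \<sigma> j + l - int ?n \<le> int (card (nbhd G v \<inter> L))" by linarith
  qed
  also have "\<dots> = (\<Sum>v\<in>H. int (card (nbhd G v \<inter> L)))"
    unfolding H_def sum_classes[OF idx(2)] ..
  finally show ?thesis using cut cardL degL cardM by simp
qed

end

text \<open>A vertex with \<open>P\<close> has neighbours of smaller and of larger degree, so it
  attains neither extreme. A minimiser \<open>b\<close> and a maximiser \<open>a\<close> are
  therefore exceptional. They differ because \<open>n \<ge> 3\<close> supplies a vertex with
  \<open>P\<close>, and so they are the only two exceptions.\<close>

lemma two_extremes_obtain: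
  assumes G: "all_but_two P n G"
    and low: "\<And>u. P G u \<Longrightarrow> \<exists>y\<in>nbhd G u. deg G y < deg G u"
    and high: "\<And>u. P G u \<Longrightarrow> \<exists>x\<in>nbhd G u. deg G u < deg G x"
  obtains a b where "two_extremes G a b" "\<And>v. v \<in> pverts G - {a, b} \<Longrightarrow> P G v"
proof -
  interpret pair_graph G using G by (simp add: all_but_two_def)
  let ?V = "pverts G" and ?d = "deg G"
  define T where "T = {u \<in> ?V. P G u}"
  have n: "card ?V = n" "3 \<le> n" "card T = n - 2"
    using G by (simp_all add: all_but_two_def T_def)
  have T: "T \<subseteq> ?V" "finite T" using pair_finite_verts by (auto simp: T_def)
  have S: "card (?V - T) = 2" using T n by (simp add: card_Diff_subset)
  have fin: "finite (?d ` ?V)" and ne: "?d ` ?V \<noteq> {}" using pair_finite_verts n by auto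
  obtain b where b: "b \<in> ?V" "?d b = Min (?d ` ?V)" using Min_in[OF fin ne] by auto
  obtain a where a: "a \<in> ?V" "?d a = Max (?d ` ?V)" using Max_in[OF fin ne] by auto
  have lo: "?d b \<le> ?d v" and hi: "?d v \<le> ?d a" if "v \<in> ?V" for v
    using that a b fin by auto
  have strict: "?d b < ?d v \<and> ?d v < ?d a" if "v \<in> T" for v
  proof -
    have v: "v \<in> ?V" "P G v" using that by (auto simp: T_def)
    obtain x y where "y \<in> nbhd G v" "?d y < ?d v" "x \<in> nbhd G v" "?d v < ?d x"
      using low[OF v(2)] high[OF v(2)] by blast
    then show ?thesis using lo[of y] hi[of x] nbhd_subset[of v] by fastforce
  qed
  have "T \<noteq> {}" using n by auto
  then have ba: "?d b < ?d a" using strict by fastforce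
  have "{a, b} \<subseteq> ?V - T" using a(1) b(1) strict[of a] strict[of b] by blast
  moreover have "card {a, b} = 2" using ba by (cases "a = b") auto
  ultimately have "?V - T = {a, b}" using S pair_finite_verts by (metis card_subset_eq finite_Diff)
  then have inner: "v \<in> T" if "v \<in> ?V - {a, b}" for v using that by auto
  have P: "P G v" if "v \<in> ?V - {a, b}" for v using inner[OF that] by (simp add: T_def)
  have "two_extremes G a b"
    by unfold_locales (use a b ba n strict inner low P in auto)
  then show ?thesis using P that by blast
qed

section \<open>Very typical vertices\<close>

text \<open>Summation by parts: going down from the last index, \<open>g i\<close> may replace
  \<open>g (Suc i)\<close> as factor of a suffix sum, since that sum is nonnegative.\<close>

lemma sum_nonneg_of_suffix_sums:
  fixes w g :: "nat \<Rightarrow> int"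
  assumes suffix: "\<And>m. m < K \<Longrightarrow> 0 \<le> (\<Sum>j=m..<K. w j)"
    and mono: "\<And>j. Suc j < K \<Longrightarrow> g j \<le> g (Suc j)"
    and g0: "0 \<le> g 0"
  shows "0 \<le> (\<Sum>j=0..<K. w j * g j)"
proof (cases "K = 0")
  case False
  have "g m * (\<Sum>j=m..<K. w j) \<le> (\<Sum>j=m..<K. w j * g j)" if "m < K" for m
    using that
  proof (induction m rule: strict_inc_induct)
    case (base i)
    then show ?case by simp
  next
    case (step i)
    show ?case
    proof (cases "Suc i < K")
      case True
      have "g i * (\<Sum>j=Suc i..<K. w j) \<le> g (Suc i) * (\<Sum>j=Suc i..<K. w j)"
        using mono[OF True] suffix[OF True] by (rule mult_right_mono)
      then show ?thesis
        using step by (simp add: sum.atLeast_Suc_lessThan algebra_simps)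
    next
      case False
      then have "K = Suc i" using step by simp
      then show ?thesis by simp
    qed
  qed
  from this[of 0] show ?thesis
    using False mult_nonneg_nonneg[OF g0 suffix[of 0]] by simp
qed simp

text \<open>The list \<open>cs\<close> holds the class sizes in order of increasing degree. Since degrees grow by at
  least one from class to class and the smallest degree is at least \<open>cs ! 1\<close>, the \<open>j\<close>-th degree is
  at least \<open>cs ! 1 + j\<close>. When all suffix sums of the weights are nonnegative, the weighted degree
  sum is minimal at these values, so that the cut inequality fails for all degrees if it fails
  there.\<close>

definition weight :: "int list \<Rightarrow> nat \<Rightarrow> nat \<Rightarrow> nat \<Rightarrow> nat \<Rightarrow> int" where
  "weight cs t s e j = (if s \<le> j \<and> j < e then cs ! j else 0) - (if j \<le> t then cs ! j else 0)"

text \<open>The strict inequality negates the cut inequality for \<open>\<epsilon> = 0\<close> and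
  \<open>\<sigma> j = cs ! j\<close> at the degrees \<open>cs ! 1 + j\<close>, with all degree-free
  terms moved to the left. Sums over lists keep it executable.\<close>

definition cut_fails :: "int list \<Rightarrow> nat \<Rightarrow> nat \<Rightarrow> nat \<Rightarrow> bool" where
  "cut_fails cs t s e \<longleftrightarrow>
    (let K = length cs; l = (\<Sum>j\<leftarrow>[0..<Suc t]. cs ! j) in
     (\<forall>m\<in>set [0..<K]. 0 \<le> (\<Sum>j\<leftarrow>[m..<K]. weight cs t s e j)) \<and>
     - 2 * (l - 1) - (if Suc t < s then cs ! Suc t else 0)
       - (\<Sum>j\<leftarrow>[s..<e]. cs ! j * (cs ! j + l - sum_list cs))
     < (\<Sum>j\<leftarrow>[0..<K]. weight cs t s e j * (cs ! 1 + int j)))"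

text \<open>The classes in \<open>H\<close> always reach the top, with the vertex of maximal degree
  (\<open>e = K\<close>) or without it (\<open>e = K - 1\<close>).\<close>

definition refuted :: "int list \<Rightarrow> bool" where
  "refuted cs \<longleftrightarrow> (let K = length cs in
     \<exists>t\<in>set [0..<K - 2]. \<exists>s\<in>set [Suc t..<K]. \<exists>e\<in>set [K - 1, K]. cut_fails cs t s e)"

text \<open>The excess \<open>D j - (cs ! 1 + int j)\<close> starts nonnegative and never decreases,
  so replacing the degrees by their lower bounds cannot increase the weighted sum.\<close>

lemma not_refuted:
  fixes D :: "nat \<Rightarrow> int"
  assumes mono: "\<And>j. Suc j < length cs \<Longrightarrow> D j + 1 \<le> D (Suc j)"
    and D0: "cs ! 1 \<le> D 0"
    and cut: "\<And>t s e. Suc t < length cs - 1 \<Longrightarrow> t < s \<Longrightarrow> e \<le> length cs \<Longrightarrow>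
      (\<Sum>j=s..<e. cs ! j * (D j + cs ! j + (\<Sum>i\<le>t. cs ! i) - sum_list cs))
        + 2 * ((\<Sum>i\<le>t. cs ! i) - 1) + (if Suc t < s then cs ! Suc t else 0)
      \<le> (\<Sum>j\<le>t. cs ! j * D j)"
  shows "\<not> refuted cs"
proof
  let ?K = "length cs"
  assume "refuted cs"
  then obtain t s e where "t \<in> set [0..<?K - 2]" "s \<in> set [Suc t..<?K]" "e \<in> set [?K - 1, ?K]"
    and fails: "cut_fails cs t s e"
    unfolding refuted_def Let_def by blast
  then have tse: "t < ?K - 2" "t < s" "e \<le> ?K" by auto
  define l where "l = (\<Sum>i\<le>t. cs ! i)"
  define w where "w = weight cs t s e"
  have list_sum: "(\<Sum>j\<leftarrow>[m..<k]. f j) = (\<Sum>j=m..<k. f j)" for m k and f :: "nat \<Rightarrow> int"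
    by (simp add: interv_sum_list_conv_sum_set_nat)
  have l: "(\<Sum>j=0..<Suc t. cs ! j) = l"
    unfolding l_def by (simp add: atLeast0LessThan lessThan_Suc_atMost)
  have suffix: "0 \<le> (\<Sum>j=m..<?K. w j)" if "m < ?K" for m
    using fails that unfolding cut_fails_def Let_def list_sum w_def by simp
  have big: "- 2 * (l - 1) - (if Suc t < s then cs ! Suc t else 0)
       - (\<Sum>j=s..<e. cs ! j * (cs ! j + l - sum_list cs)) < (\<Sum>j=0..<?K. w j * (cs ! 1 + int j))"
    using fails unfolding cut_fails_def Let_def list_sum w_def l by blast
  have "0 \<le> (\<Sum>j=0..<?K. w j * (D j - (cs ! 1 + int j)))"
  proof (rule sum_nonneg_of_suffix_sums[OF suffix])
    fix j assume "Suc j < ?K"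
    then show "D j - (cs ! 1 + int j) \<le> D (Suc j) - (cs ! 1 + int (Suc j))"
      using mono[of j] by simp
  qed (use D0 in simp_all)
  then have "(\<Sum>j=0..<?K. w j * (cs ! 1 + int j)) \<le> (\<Sum>j=0..<?K. w j * D j)"
    by (simp add: right_diff_distrib sum_subtractf)
  also have "\<dots> = (\<Sum>j=0..<?K. if s \<le> j \<and> j < e then cs ! j * D j else 0)
      - (\<Sum>j=0..<?K. if j \<le> t then cs ! j * D j else 0)"
    unfolding w_def weight_def sum_subtractf[symmetric]
    by (intro sum.cong) (auto simp: algebra_simps)
  also have "\<dots> = (\<Sum>j=s..<e. cs ! j * D j) - (\<Sum>j\<le>t. cs ! j * D j)"
    using tse by (simp add: sum.inter_filter[symmetric])
      (intro arg_cong2[where f = minus] sum.cong; auto)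
  finally have "(\<Sum>j=0..<?K. w j * (cs ! 1 + int j))
      \<le> (\<Sum>j=s..<e. cs ! j * D j) - (\<Sum>j\<le>t. cs ! j * D j)" .
  moreover have "(\<Sum>j=s..<e. cs ! j * (D j + cs ! j + l - sum_list cs))
      = (\<Sum>j=s..<e. cs ! j * D j) + (\<Sum>j=s..<e. cs ! j * (cs ! j + l - sum_list cs))"
    by (simp add: sum.distrib[symmetric] algebra_simps)
  ultimately show False
    using cut[of t s e] tse big unfolding l_def[symmetric] by linarith
qed

text \<open>Ordered partitions of \<open>m\<close> into positive parts: the first part is 1 or
  arises by raising the first part of a smaller composition. The filter drops the empty list, whose
  \<open>hd\<close> is unspecified.\<close>

fun compositions :: "nat \<Rightarrow> int list list" where
  "compositions 0 = [[]]"
| "compositions (Suc m) =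
     map ((#) 1) (compositions m) @
     map (\<lambda>cs. (hd cs + 1) # tl cs) (filter (\<lambda>cs. cs \<noteq> []) (compositions m))"

lemma compositions_complete:
  "\<forall>x\<in>set xs. 1 \<le> x \<Longrightarrow> sum_list xs = int m \<Longrightarrow> xs \<in> set (compositions m)"
proof (induction m arbitrary: xs)
  case 0
  then show ?case
  proof (cases xs)
    case (Cons y ys)
    then have "0 \<le> sum_list ys" using 0 by (intro sum_list_nonneg) auto
    then show ?thesis using 0 Cons by simp
  qed simp
next
  case (Suc m)
  then have "xs \<noteq> []" by auto
  then obtain y ys where xs: "xs = y # ys" using list.exhaust by blast
  show ?case
  proof (cases "y = 1")
    case True
    then have "ys \<in> set (compositions m)" using Suc xs by simp
    then show ?thesis using xs True by simp
  next
    case False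
    then have "(y - 1) # ys \<in> set (compositions m)" using Suc xs by (intro Suc.IH) auto
    then have "xs \<in> (\<lambda>cs. (hd cs + 1) # tl cs) ` set (filter (\<lambda>cs. cs \<noteq> []) (compositions m))"
      by (intro image_eqI[of _ _ "(y - 1) # ys"]) (simp_all add: xs)
    then show ?thesis by (simp del: set_filter)
  qed
qed

text \<open>Here \<open>m = n - 2\<close> for the orders from 3 to 9; the two outer ones are the
  classes of \<open>b\<close> and \<open>a\<close>.\<close>

lemma compositions_refuted:
  "\<forall>m\<in>set [1..<8]. \<forall>cs\<in>set (compositions m). refuted (1 # cs @ [1])"
  by code_simp

text \<open>The class sizes of a counterexample would be refuted by the finite check, yet not
  refuted because \<open>class_cut\<close> holds for every choice of classes.\<close>

lemma very_typical_order:
  assumes G: "all_but_two very_typical n G"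
  shows "10 \<le> n"
proof (rule ccontr)
  assume "\<not> 10 \<le> n"
  obtain a b where "two_extremes G a b"
    and vt: "\<And>v. v \<in> pverts G - {a, b} \<Longrightarrow> very_typical G v"
    by (rule two_extremes_obtain[OF G]) (auto simp: very_typical_def)
  interpret two_extremes G a b by fact
  have n: "n = card (pverts G)" using G by (simp add: all_but_two_def)
  \<comment> \<open>Classes are independent sets: inner ones by very typicality, the extreme ones as
    singletons. Hence \<sigma> may be the class size.\<close>
  have indep: "C j - nbhd G v = C j" if "v \<in> C j" for j v
  proof -
    have "u \<notin> nbhd G v" if u: "u \<in> C j" for u
    proof
      assume uv: "u \<in> nbhd G v"
      have eq: "deg G u = deg G v" "u \<in> pverts G" "v \<in> pverts G"
        using u \<open>v \<in> C j\<close> by (auto simp: C_def)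
      then have "v \<in> {a, b}" using vt[of v] uv by (auto simp: very_typical_def)
      moreover from this have "u \<in> {a, b}" using eq extremal[of u] by fastforce
      ultimately have "u = v" using eq(1) ba by auto
      then show False using uv nbhd_irrefl by simp
    qed
    then show ?thesis by blast
  qed
  let ?K = "num_degrees"
  define cs where "cs = map c [0..<?K]"
  have K: "length cs = ?K" "3 \<le> ?K" using num_degrees_ge by (simp_all add: cs_def)
  have nth: "cs ! j = c j" if "j < ?K" for j using that by (simp add: cs_def)
  have sum_cs: "sum_list cs = int n"
    unfolding cs_def n order_eq by (simp add: interv_sum_list_conv_sum_set_nat atLeast0LessThan)
  have cut: "(\<Sum>j=s..<e. cs ! j * (int (D j) + cs ! j + (\<Sum>i\<le>t. cs ! i) - sum_list cs))
        + 2 * ((\<Sum>i\<le>t. cs ! i) - 1) + (if Suc t < s then cs ! Suc t else 0)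
      \<le> (\<Sum>j\<le>t. cs ! j * int (D j))"
    if "Suc t < length cs - 1" "t < s" "e \<le> length cs" for t s e
  proof -
    have class_sizes: "(\<Sum>i\<le>t. cs ! i) = (\<Sum>i\<le>t. c i)"
      "(\<Sum>j\<le>t. cs ! j * int (D j)) = (\<Sum>j\<le>t. c j * int (D j))"
      "(if Suc t < s then cs ! Suc t else 0) = (if Suc t < s then c (Suc t) else 0)"
      "(\<Sum>j=s..<e. cs ! j * (int (D j) + cs ! j + l - sum_list cs))
        = (\<Sum>j=s..<e. c j * (int (D j) + c j + l - int (card (pverts G))))" for l
      using that K unfolding sum_cs n by (auto intro!: sum.cong simp: nth)
    have "(\<Sum>j=s..<e. c j * (int (D j) + c j + (\<Sum>i\<le>t. c i) - int (card (pverts G))))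
        + (2 + int 0) * ((\<Sum>i\<le>t. c i) - 1) + (if Suc t < s then c (Suc t) else 0)
      \<le> (\<Sum>j\<le>t. c j * int (D j))"
      using that K by (intro class_cut) (auto simp: indep c_def)
    then show ?thesis by (simp only: class_sizes of_nat_0 add_0_right)
  qed
  have first: "cs ! 0 = 1" using nth[of 0] K C_first by (simp add: c_def)
  have "\<not> refuted cs"
  proof (rule not_refuted[OF _ _ cut])
    fix j assume "Suc j < length cs"
    then show "int (D j) + 1 \<le> int (D (Suc j))" using D_strict[of j "Suc j"] K by simp
  next
    \<comment> \<open>With \<open>L = {b}\<close> and empty \<open>H\<close>, the cut inequality
      says that \<open>b\<close> is adjacent to the whole second class.\<close>
    show "cs ! 1 \<le> int (D 0)"
      using cut[of 0 ?K ?K] K first by simp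
  qed
  moreover have "refuted cs"
  proof -
    define mid where "mid = map c [1..<?K - 1]"
    define k where "k = ?K - 2"
    have k: "?K = Suc (Suc k)" using K by (simp add: k_def)
    have ends: "c 0 = 1" "c (Suc k) = 1" using C_first C_last k by (simp_all add: c_def)
    have "[0..<Suc (Suc k)] = 0 # [1..<Suc k] @ [Suc k]"
      using upt_conv_Cons[of 0 "Suc k"] upt_Suc_append[of 0 "Suc k"] by (simp del: upt_Suc)
    then have cs: "cs = 1 # mid @ [1]"
      unfolding cs_def mid_def k using ends by (simp del: upt_Suc)
    have "sum_list mid = int (n - 2)" using sum_cs cs G by (simp add: all_but_two_def)
    moreover have "\<forall>x\<in>set mid. 1 \<le> x" using c_pos unfolding mid_def by auto
    ultimately have "mid \<in> set (compositions (n - 2))" by (intro compositions_complete)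
    moreover have "n - 2 \<in> set [1..<8]" using \<open>\<not> 10 \<le> n\<close> G by (auto simp: all_but_two_def)
    ultimately show ?thesis unfolding cs by (rule compositions_refuted[rule_format, rotated])
  qed
  ultimately show False by contradiction
qed

section \<open>Typical vertices\<close>

text \<open>A typical vertex has a neighbour in its own class, so inner classes have at least two
  members. For \<open>n \<le> 8\<close> at most three inner classes remain, few enough to treat by
  hand with \<open>\<epsilon> = 1\<close> and \<open>\<sigma> = 1\<close>.\<close>

lemma typical_order:
  assumes G: "all_but_two typical n G"
  shows "9 \<le> n"
proof (rule ccontr)
  assume "\<not> 9 \<le> n"
  obtain a b where "two_extremes G a b"
    and all_typical: "\<And>v. v \<in> pverts G - {a, b} \<Longrightarrow> typical G v"
    by (rule two_extremes_obtain[OF G]) (auto simp: typical_def)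
  interpret two_extremes G a b by fact
  let ?K = "num_degrees"
  have n: "int (card (pverts G)) = int n" using G by (simp add: all_but_two_def)
  have eq: "\<exists>u\<in>nbhd G v. deg G u = deg G v" if "v \<in> pverts G - {a, b}" for v
    using all_typical[OF that] by (metis typical_def)
  have cut: "(\<Sum>j=s..<e. c j * (int (D j) + 1 + (\<Sum>i\<le>t. c i) - int n))
      + 3 * ((\<Sum>i\<le>t. c i) - 1) + (if Suc t < s then c (Suc t) else 0) \<le> (\<Sum>j\<le>t. c j * int (D j))"
    if "Suc t < ?K - 1" "t < s" "e \<le> ?K" for t s e
  proof -
    have "1 \<le> card {u \<in> nbhd G v. deg G u = deg G v}" if "v \<in> pverts G - {a, b}" for v
      using eq[OF that] finite_nbhd by (auto simp: Suc_le_eq card_gt_0_iff)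
    moreover have "1 \<le> int (card (C j - nbhd G v))" if "v \<in> C j" for j v
    proof -
      have "v \<in> C j - nbhd G v" using that nbhd_irrefl by simp
      then show ?thesis using finite_C[of j] by (simp add: Suc_le_eq card_gt_0_iff) blast
    qed
    ultimately show ?thesis
      using class_cut[of t s e 1 "\<lambda>_. 1"] that n by simp
  qed
  have c2: "2 \<le> c j" if j: "0 < j" "j < ?K - 1" for j
  proof -
    have jK: "j < ?K" "j \<noteq> 0" "j \<noteq> ?K - 1" using j by auto
    have "C j \<noteq> {}" using c_pos[OF jK(1)] by (auto simp: c_def)
    then obtain v where v: "v \<in> C j" by blast
    have "v \<notin> {a, b}"
      using v C_first C_last C_disjoint[of j 0] C_disjoint[of j "?K - 1"] jK by auto
    then obtain u where u: "u \<in> nbhd G v" "deg G u = deg G v"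
      using eq[of v] v by (auto simp: C_def)
    have "{u, v} \<subseteq> C j" using u v nbhd_subset by (auto simp: C_def)
    moreover have "u \<noteq> v" using u nbhd_irrefl by auto
    ultimately show ?thesis using card_mono[OF finite_C, of "{u, v}" j] by (simp add: c_def)
  qed
  \<comment> \<open>\<open>k\<close> counts the classes strictly between the extremes.\<close>
  define k where "k = ?K - 2"
  have k: "?K = Suc (Suc k)" using num_degrees_ge by (simp add: k_def)
  have ends: "c 0 = 1" "c (Suc k) = 1" using C_first C_last k by (simp_all add: c_def)
  have "(\<Sum>j<?K. c j) = c 0 + (\<Sum>j=1..<Suc k. c j) + c (Suc k)"
    unfolding k lessThan_atLeast0 by (simp add: sum.atLeast_Suc_lessThan)
  then have total: "int n = 2 + (\<Sum>j=1..<Suc k. c j)"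
    using ends order_eq n by simp
  have "(\<Sum>j=1..<Suc k. 2) \<le> (\<Sum>j=1..<Suc k. c j)"
    using c2 k by (intro sum_mono) auto
  then have "k \<le> 3" using total \<open>\<not> 9 \<le> n\<close> by simp
  then consider "k = 1" | "k = 2" | "k = 3" using num_degrees_ge k by linarith
  then show False
  proof cases
    case 1
    \<comment> \<open>For \<open>L = {b}\<close>, \<open>H = {a}\<close> and \<open>M\<close> the
      middle class, the cut inequality reduces to \<open>D 2 \<le> D 0\<close>.\<close>
    show ?thesis
      using cut[of 0 2 3] total ends D_strict[of 0 2] 1 k
      by (simp add: eval_nat_numeral)
  next
    case 2
    have c: "2 \<le> c 1" "2 \<le> c 2" "c 1 + c 2 \<le> 6" "int n = 2 + c 1 + c 2"
      using c2[of 1] c2[of 2] 2 k total \<open>\<not> 9 \<le> n\<close> by (auto simp: eval_nat_numeral)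
    then have "c 1 = 2 \<and> c 2 = 2 \<or> c 1 = 2 \<and> c 2 = 3 \<or> c 1 = 3 \<and> c 2 = 2
      \<or> c 1 = 2 \<and> c 2 = 4 \<or> c 1 = 3 \<and> c 2 = 3 \<or> c 1 = 4 \<and> c 2 = 2" by linarith
    \<comment> \<open>Once the sizes are fixed, the products \<open>c j * D j\<close> are linear in
      the degrees, and the cuts contradict the strict increase of \<open>D\<close>.\<close>
    then show ?thesis
      using cut[of 0 4 4] cut[of 0 3 4] cut[of 1 2 3] cut[of 1 2 4] cut[of 1 4 4] c(4) ends
        D_strict[of 0 1] D_strict[of 1 2] D_strict[of 2 3] 2 k
      by (elim disjE conjE) (simp_all add: eval_nat_numeral)
  next
    case 3
    have "c 1 = 2" "c 2 = 2" "c 3 = 2" "n = 8"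
      using c2[of 1] c2[of 2] c2[of 3] 3 k total \<open>\<not> 9 \<le> n\<close> by (auto simp: eval_nat_numeral)
    \<comment> \<open>The cut with \<open>L\<close> the two lowest classes and \<open>H\<close> the
      two highest gives \<open>2 * D 3 + D 4 - 4 \<le> D 0 + 2 * D 1\<close>, whereas strict
      increase makes \<open>2 * (D 3 - D 1) + (D 4 - D 0)\<close> at least 8.\<close>
    then show ?thesis
      using cut[of 0 5 5] cut[of 1 3 5] ends
        D_strict[of 0 1] D_strict[of 1 2] D_strict[of 2 3] D_strict[of 3 4] 3 k
      by (simp add: eval_nat_numeral)
  qed
qed

section \<open>Examples of minimal order\<close>

definition graph_of :: "nat list list \<Rightarrow> nat pair_pre_digraph" where
  "graph_of Ns = \<lparr>pverts = {..<length Ns}, parcs = {(u, v). u < length Ns \<and> v \<in> set (Ns ! u)}\<rparr>"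

text \<open>Distinctness makes the length of a list the degree of its vertex, so the degree
  conditions can be checked by evaluation.\<close>

definition adjacency_lists :: "nat list list \<Rightarrow> bool" where
  "adjacency_lists Ns \<longleftrightarrow> (\<forall>u<length Ns. distinct (Ns ! u) \<and>
     (\<forall>v\<in>set (Ns ! u). v < length Ns \<and> v \<noteq> u \<and> u \<in> set (Ns ! v)))"

lemma
  assumes "adjacency_lists Ns"
  shows pair_graph_graph_of: "pair_graph (graph_of Ns)"
    and nbhd_graph_of: "u < length Ns \<Longrightarrow> nbhd (graph_of Ns) u = set (Ns ! u)"
    and deg_graph_of: "u < length Ns \<Longrightarrow> deg (graph_of Ns) u = length (Ns ! u)"
proof -
  have Ns: "\<forall>u<length Ns. distinct (Ns ! u) \<and>
      (\<forall>v\<in>set (Ns ! u). v < length Ns \<and> v \<noteq> u \<and> u \<in> set (Ns ! v))"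
    using assms unfolding adjacency_lists_def .
  have parcs: "parcs (graph_of Ns) = {(u, v). u < length Ns \<and> v \<in> set (Ns ! u)}"
    and pverts: "pverts (graph_of Ns) = {..<length Ns}"
    by (simp_all add: graph_of_def)
  have sub: "parcs (graph_of Ns) \<subseteq> {..<length Ns} \<times> {..<length Ns}"
    unfolding parcs using Ns by blast
  have fin: "finite (parcs (graph_of Ns))" using sub by (rule finite_subset) simp
  have sym: "sym (parcs (graph_of Ns))" unfolding parcs using Ns by (intro symI) blast
  have "(u, u) \<notin> parcs (graph_of Ns)" for u unfolding parcs using Ns by blast
  then have irrefl: "fst e \<noteq> snd e" if "e \<in> parcs (graph_of Ns)" for e
    using that by (metis prod.collapse)
  have "fst e \<in> pverts (graph_of Ns)" "snd e \<in> pverts (graph_of Ns)" if "e \<in> parcs (graph_of Ns)" for e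
    using subsetD[OF sub that] by (auto simp: pverts)
  then show G: "pair_graph (graph_of Ns)"
    by unfold_locales (use fin sym irrefl in \<open>simp_all add: pverts symmetric_def\<close>)
  show nbhd: "nbhd (graph_of Ns) u = set (Ns ! u)" if "u < length Ns" for u
    using that by (auto simp: nbhd_def graph_of_def)
  show "deg (graph_of Ns) u = length (Ns ! u)" if "u < length Ns" for u
    using Ns that nbhd[OF that] by (simp add: pair_graph.deg_eq_card_nbhd[OF G] distinct_card)
qed

lemma all_but_two_graph_of:
  assumes Ns: "adjacency_lists Ns" "3 \<le> length Ns"
    and P: "\<And>u. u < length Ns \<Longrightarrow> P (graph_of Ns) u \<longleftrightarrow> Q u"
    and Q: "length (filter Q [0..<length Ns]) = length Ns - 2"
  shows "all_but_two P (length Ns) (graph_of Ns)"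
proof -
  have V: "pverts (graph_of Ns) = {..<length Ns}" by (simp add: graph_of_def)
  have "{u \<in> {..<length Ns}. P (graph_of Ns) u} = set (filter Q [0..<length Ns])" using P by auto
  then show ?thesis
    using Q pair_graph_graph_of[OF Ns(1)] Ns(2) unfolding all_but_two_def V
    by (simp add: distinct_card del: set_filter)
qed

definition very_typical_at :: "nat list list \<Rightarrow> nat \<Rightarrow> bool" where
  "very_typical_at Ns u \<longleftrightarrow> (let d = \<lambda>v. length (Ns ! v) in
    2 \<le> d u \<and> (\<forall>v\<in>set (Ns ! u). d v \<noteq> d u) \<and>
    (\<exists>x\<in>set (Ns ! u). d u < d x) \<and> (\<exists>y\<in>set (Ns ! u). d y < d u))"

definition typical_at :: "nat list list \<Rightarrow> nat \<Rightarrow> bool" where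
  "typical_at Ns u \<longleftrightarrow> (let d = \<lambda>v. length (Ns ! v) in
    3 \<le> d u \<and> (\<exists>x\<in>set (Ns ! u). \<exists>y\<in>set (Ns ! u). \<exists>z\<in>set (Ns ! u).
      x \<noteq> y \<and> y \<noteq> z \<and> x \<noteq> z \<and> d x < d u \<and> d u = d y \<and> d y < d z))"

lemma
  assumes Ns: "adjacency_lists Ns" and u: "u < length Ns"
  shows very_typical_graph_of: "very_typical (graph_of Ns) u \<longleftrightarrow> very_typical_at Ns u"
    and typical_graph_of: "typical (graph_of Ns) u \<longleftrightarrow> typical_at Ns u"
proof -
  have "v < length Ns" if "v \<in> set (Ns ! u)" for v
    using Ns u that unfolding adjacency_lists_def by blast
  then show "very_typical (graph_of Ns) u \<longleftrightarrow> very_typical_at Ns u"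
    and "typical (graph_of Ns) u \<longleftrightarrow> typical_at Ns u"
    using u by (simp_all add: very_typical_def very_typical_at_def typical_def typical_at_def
        nbhd_graph_of[OF Ns] deg_graph_of[OF Ns] Let_def)
qed

lemma ex_very_typical: "\<exists>G :: nat pair_pre_digraph. all_but_two very_typical 10 G"
proof -
  \<comment> \<open>Degrees 2, 3, 4, 5, 6 with class sizes 1, 2, 4, 2, 1; the exceptions are 0 and
    9. The classes {3,4,5,6} and {7,8} are completely joined, and 9 is joined to both.\<close>
  let ?Ns = "[[1,2], [0,3,4], [0,5,6], [1,7,8,9], [1,7,8,9], [2,7,8,9], [2,7,8,9],
    [3,4,5,6,9], [3,4,5,6,9], [3,4,5,6,7,8]] :: nat list list"
  have Ns: "adjacency_lists ?Ns" by code_simp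
  have Q: "length (filter (very_typical_at ?Ns) [0..<length ?Ns]) = length ?Ns - 2" by code_simp
  have "all_but_two very_typical (length ?Ns) (graph_of ?Ns)"
    by (rule all_but_two_graph_of[where P = very_typical, OF Ns _ very_typical_graph_of[OF Ns] Q]) simp
  then have "all_but_two very_typical 10 (graph_of ?Ns)" by (simp add: eval_nat_numeral)
  then show ?thesis by (rule exI)
qed

lemma ex_typical: "\<exists>G :: nat pair_pre_digraph. all_but_two typical 9 G"
proof -
  \<comment> \<open>Degrees 5, 6, 7, 8 with class sizes 1, 4, 3, 1; the exceptions are 0 and 8. The
    edges 12 and 34 and the triangle 567 give the equal-degree neighbours, the two inner classes are
    completely joined, and 8 is adjacent to all.\<close>
  let ?Ns = "[[1,2,3,4,8], [0,2,5,6,7,8], [0,1,5,6,7,8], [0,4,5,6,7,8], [0,3,5,6,7,8],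
    [1,2,3,4,6,7,8], [1,2,3,4,5,7,8], [1,2,3,4,5,6,8], [0,1,2,3,4,5,6,7]] :: nat list list"
  have Ns: "adjacency_lists ?Ns" by code_simp
  have Q: "length (filter (typical_at ?Ns) [0..<length ?Ns]) = length ?Ns - 2" by code_simp
  have "all_but_two typical (length ?Ns) (graph_of ?Ns)"
    by (rule all_but_two_graph_of[where P = typical, OF Ns _ typical_graph_of[OF Ns] Q]) simp
  then have "all_but_two typical 9 (graph_of ?Ns)" by (simp add: eval_nat_numeral)
  then show ?thesis by (rule exI)
qed

theorem corollary2:
  shows "(\<exists>G :: nat pair_pre_digraph. all_but_two very_typical 10 G) \<and>
         (\<forall>n. \<forall>G :: 'a pair_pre_digraph. all_but_two very_typical n G \<longrightarrow> 10 \<le> n) \<and>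
         (\<exists>G :: nat pair_pre_digraph. all_but_two typical 9 G) \<and>
         (\<forall>n. \<forall>G :: 'a pair_pre_digraph. all_but_two typical n G \<longrightarrow> 9 \<le> n)"
  using ex_very_typical very_typical_order ex_typical typical_order by blast

end
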